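(* Let $C$ be a linear code of length $n$ over $R$, with associated codes $C_1,C_2,C_3\subseteq\mathbb{F}_{p^k}^n$. Then $C^{\perp}=e_1C_1^{\perp}\oplus e_2C_2^{\perp}\oplus e_3C_3^{\perp}$.
   Context: Let $p$ be a prime, $k\ge1$ and $r>1$ integers with $\gcd(r,p)=1$, and $R_r=\mathbb{F}_{p^k}[v]/\langle v^{r+1}-v\rangle$. In $R_r$ put $e_1=\frac1r(v+v^2+\dots+v^r)$, $e_2=-\frac1r(v+\dots+v^{r-1})+\frac{r-1}{r}v^r$, $e_3=1-v^r$; these are nonzero orthogonal idempotents with sum $1$. $R$ denotes the subring $R=e_1\mathbb{F}_{p^k}\oplus e_2\mathbb{F}_{p^k}\oplus e_3\mathbb{F}_{p^k}$ of $R_r$. A linear code of length $n$ over a commutative ring $A$ is an $A$-submodule of $A^n$, and its dual is $C^\perp=\{y\in A^n : \sum_j y_jc_j=0\ \forall c\in C\}$ (here $A=R$ for $C$ and $A=\mathbb{F}_{p^k}$ for the $C_i$). For a linear code $C$ over $R$, the associated codes are $C_1=\{s : \exists\, t,u\in\mathbb{F}_{p^k}^n,\ e_1s+e_2t+e_3u\in C\}$, $C_2=\{t : \exists\, s,u\in\mathbb{F}_{p^k}^n,\ e_1s+e_2t+e_3u\in C\}$, $C_3=\{u : \exists\, s,t\in\mathbb{F}_{p^k}^n,\ e_1s+e_2t+e_3u\in C\}$. *)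

theory Defs
  imports "HOL-Algebra.Polynomial_Divisibility" "HOL-Algebra.Module" "HOL-Computational_Algebra.Primes"
begin

section \<open>Linear codes over a commutative ring\<close>

text \<open>The module \<open>A\<^sup>n\<close>: vectors are extensional functions on \<open>{..<n}\<close>. The fields \<^const>\<open>mult\<close>
  and \<^const>\<open>one\<close>, which the record type requires, play no role for modules.\<close>

definition vec_module :: "('a, 'm) ring_scheme \<Rightarrow> nat \<Rightarrow> ('a, nat \<Rightarrow> 'a) module" where
  "vec_module A n =
     \<lparr> carrier = {..<n} \<rightarrow>\<^sub>E carrier A,
       mult = (\<lambda>x y. \<lambda>j\<in>{..<n}. x j \<otimes>\<^bsub>A\<^esub> y j),
       one = (\<lambda>j\<in>{..<n}. \<one>\<^bsub>A\<^esub>),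
       zero = (\<lambda>j\<in>{..<n}. \<zero>\<^bsub>A\<^esub>),
       add = (\<lambda>x y. \<lambda>j\<in>{..<n}. x j \<oplus>\<^bsub>A\<^esub> y j),
       smult = (\<lambda>a x. \<lambda>j\<in>{..<n}. a \<otimes>\<^bsub>A\<^esub> x j) \<rparr>"

definition linear_code :: "('a, 'm) ring_scheme \<Rightarrow> nat \<Rightarrow> (nat \<Rightarrow> 'a) set \<Rightarrow> bool" where
  "linear_code A n C \<longleftrightarrow> submodule C A (vec_module A n)"

definition dual_code :: "('a, 'm) ring_scheme \<Rightarrow> nat \<Rightarrow> (nat \<Rightarrow> 'a) set \<Rightarrow> (nat \<Rightarrow> 'a) set" where
  "dual_code A n C =
     {y \<in> carrier (vec_module A n). \<forall>c\<in>C. (\<Oplus>\<^bsub>A\<^esub>j\<in>{..<n}. y j \<otimes>\<^bsub>A\<^esub> c j) = \<zero>\<^bsub>A\<^esub>}"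

definition internal_direct_sum3 ::
  "('a, 'm) ring_scheme \<Rightarrow> ('a, 'b) module \<Rightarrow> 'b set \<Rightarrow> 'b set \<Rightarrow> 'b set \<Rightarrow> 'b set \<Rightarrow> bool" where
  "internal_direct_sum3 A M D D1 D2 D3 \<longleftrightarrow>
     submodule D1 A M \<and> submodule D2 A M \<and> submodule D3 A M \<and>
     D = D1 <+>\<^bsub>M\<^esub> D2 <+>\<^bsub>M\<^esub> D3 \<and>
     (\<forall>x\<in>D1. \<forall>y\<in>D2. \<forall>z\<in>D3. \<forall>x'\<in>D1. \<forall>y'\<in>D2. \<forall>z'\<in>D3.
        x \<oplus>\<^bsub>M\<^esub> y \<oplus>\<^bsub>M\<^esub> z = x' \<oplus>\<^bsub>M\<^esub> y' \<oplus>\<^bsub>M\<^esub> z' \<longrightarrow> x = x' \<and> y = y' \<and> z = z')"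


section \<open>The ring \<open>K[v] / (v\<^bsup>r+1\<^esup> - v)\<close> and its idempotents\<close>

definition Rr_poly :: "('a, 'm) ring_scheme \<Rightarrow> nat \<Rightarrow> 'a list" where
  "Rr_poly K r = X\<^bsub>K\<^esub> [^]\<^bsub>poly_ring K\<^esub> (r + 1) \<ominus>\<^bsub>poly_ring K\<^esub> X\<^bsub>K\<^esub>"

definition Rr :: "('a, 'm) ring_scheme \<Rightarrow> nat \<Rightarrow> 'a list set ring" where
  "Rr K r = Rupt\<^bsub>K\<^esub> (carrier K) (Rr_poly K r)"

definition Rr_class :: "('a, 'm) ring_scheme \<Rightarrow> nat \<Rightarrow> 'a list \<Rightarrow> 'a list set" where
  "Rr_class K r q = PIdl\<^bsub>poly_ring K\<^esub> (Rr_poly K r) +>\<^bsub>poly_ring K\<^esub> q"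

definition Rr_v :: "('a, 'm) ring_scheme \<Rightarrow> nat \<Rightarrow> 'a list set" where
  "Rr_v K r = Rr_class K r X\<^bsub>K\<^esub>"

definition Rr_const :: "('a, 'm) ring_scheme \<Rightarrow> nat \<Rightarrow> 'a \<Rightarrow> 'a list set" where
  "Rr_const K r a = Rr_class K r (ring.poly_of_const K a)"

definition inv_nat :: "('a, 'm) ring_scheme \<Rightarrow> nat \<Rightarrow> 'a" where
  "inv_nat K r = inv\<^bsub>K\<^esub> ([r] \<cdot>\<^bsub>K\<^esub> \<one>\<^bsub>K\<^esub>)"

definition e1 :: "('a, 'm) ring_scheme \<Rightarrow> nat \<Rightarrow> 'a list set" where
  "e1 K r = Rr_const K r (inv_nat K r) \<otimes>\<^bsub>Rr K r\<^esub>
              (\<Oplus>\<^bsub>Rr K r\<^esub>i\<in>{1..r}. Rr_v K r [^]\<^bsub>Rr K r\<^esub> i)"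

definition e2 :: "('a, 'm) ring_scheme \<Rightarrow> nat \<Rightarrow> 'a list set" where
  "e2 K r = \<ominus>\<^bsub>Rr K r\<^esub> (Rr_const K r (inv_nat K r) \<otimes>\<^bsub>Rr K r\<^esub>
                        (\<Oplus>\<^bsub>Rr K r\<^esub>i\<in>{1..r - 1}. Rr_v K r [^]\<^bsub>Rr K r\<^esub> i))
            \<oplus>\<^bsub>Rr K r\<^esub> Rr_const K r ([(r - 1)] \<cdot>\<^bsub>K\<^esub> inv_nat K r) \<otimes>\<^bsub>Rr K r\<^esub> Rr_v K r [^]\<^bsub>Rr K r\<^esub> r"

definition e3 :: "('a, 'm) ring_scheme \<Rightarrow> nat \<Rightarrow> 'a list set" where
  "e3 K r = \<one>\<^bsub>Rr K r\<^esub> \<ominus>\<^bsub>Rr K r\<^esub> Rr_v K r [^]\<^bsub>Rr K r\<^esub> r"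

text \<open>The subring \<open>e\<^sub>1K + e\<^sub>2K + e\<^sub>3K\<close> of \<^const>\<open>Rr\<close>, with the operations of \<^const>\<open>Rr\<close>. It is
  a proper subring unless \<open>r = 2\<close>.\<close>

definition Rsub :: "('a, 'm) ring_scheme \<Rightarrow> nat \<Rightarrow> 'a list set ring" where
  "Rsub K r = (Rr K r)
     \<lparr> carrier := {e1 K r \<otimes>\<^bsub>Rr K r\<^esub> Rr_const K r a \<oplus>\<^bsub>Rr K r\<^esub> e2 K r \<otimes>\<^bsub>Rr K r\<^esub> Rr_const K r b
                     \<oplus>\<^bsub>Rr K r\<^esub> e3 K r \<otimes>\<^bsub>Rr K r\<^esub> Rr_const K r c
                   | a b c. a \<in> carrier K \<and> b \<in> carrier K \<and> c \<in> carrier K} \<rparr>"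


section \<open>The codes associated with a code over \<^const>\<open>Rsub\<close>\<close>

text \<open>The vector \<open>e s\<close> over \<^const>\<open>Rsub\<close>, for a vector \<open>s\<close> over \<open>K\<close>.\<close>

definition scale_vec ::
  "('a, 'm) ring_scheme \<Rightarrow> nat \<Rightarrow> nat \<Rightarrow> 'a list set \<Rightarrow> (nat \<Rightarrow> 'a) \<Rightarrow> (nat \<Rightarrow> 'a list set)" where
  "scale_vec K r n e s = (\<lambda>j\<in>{..<n}. e \<otimes>\<^bsub>Rr K r\<^esub> Rr_const K r (s j))"

definition comb_vec ::
  "('a, 'm) ring_scheme \<Rightarrow> nat \<Rightarrow> nat \<Rightarrow> (nat \<Rightarrow> 'a) \<Rightarrow> (nat \<Rightarrow> 'a) \<Rightarrow> (nat \<Rightarrow> 'a)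
     \<Rightarrow> (nat \<Rightarrow> 'a list set)" where
  "comb_vec K r n s t u =
     scale_vec K r n (e1 K r) s \<oplus>\<^bsub>vec_module (Rsub K r) n\<^esub> scale_vec K r n (e2 K r) t
       \<oplus>\<^bsub>vec_module (Rsub K r) n\<^esub> scale_vec K r n (e3 K r) u"

definition code1 ::
  "('a, 'm) ring_scheme \<Rightarrow> nat \<Rightarrow> nat \<Rightarrow> (nat \<Rightarrow> 'a list set) set \<Rightarrow> (nat \<Rightarrow> 'a) set" where
  "code1 K r n C = {s \<in> carrier (vec_module K n).
     \<exists>t\<in>carrier (vec_module K n). \<exists>u\<in>carrier (vec_module K n). comb_vec K r n s t u \<in> C}"

definition code2 ::
  "('a, 'm) ring_scheme \<Rightarrow> nat \<Rightarrow> nat \<Rightarrow> (nat \<Rightarrow> 'a list set) set \<Rightarrow> (nat \<Rightarrow> 'a) set" where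
  "code2 K r n C = {t \<in> carrier (vec_module K n).
     \<exists>s\<in>carrier (vec_module K n). \<exists>u\<in>carrier (vec_module K n). comb_vec K r n s t u \<in> C}"

definition code3 ::
  "('a, 'm) ring_scheme \<Rightarrow> nat \<Rightarrow> nat \<Rightarrow> (nat \<Rightarrow> 'a list set) set \<Rightarrow> (nat \<Rightarrow> 'a) set" where
  "code3 K r n C = {u \<in> carrier (vec_module K n).
     \<exists>s\<in>carrier (vec_module K n). \<exists>t\<in>carrier (vec_module K n). comb_vec K r n s t u \<in> C}"

end

theory Submission
  imports Defs "HOL-Algebra.Multiplicative_Group"
begin

text \<open>Since \<open>e\<^sub>1, e\<^sub>2, e\<^sub>3\<close> are nonzero orthogonal idempotents with sum \<open>1\<close> and \<open>K\<close> is a field,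
  \<open>(a, b, c) \<mapsto> e\<^sub>1a + e\<^sub>2b + e\<^sub>3c\<close> is a ring isomorphism from \<open>K \<times> K \<times> K\<close> onto \<^const>\<open>Rsub\<close>. Under it the
  inner product is computed componentwise, so a vector is orthogonal to a code iff each of its three
  components is orthogonal to the corresponding associated code.

  With \<open>w = v\<^sup>r\<close> one has \<open>v e\<^sub>1 = e\<^sub>1\<close>, \<open>w\<^sup>2 = w\<close>, \<open>e\<^sub>2 = w - e\<^sub>1\<close> and \<open>e\<^sub>3 = 1 - w\<close>, which gives all the
  idempotent relations. Evaluation at \<open>v = 1\<close> and \<open>v = 0\<close> shows that \<open>e\<^sub>1\<close> and \<open>e\<^sub>3\<close> are nonzero, while
  \<open>e\<^sub>2 = 0\<close> would force \<open>v\<^sup>2 = v\<close>, contradicting the degree of \<open>v\<^sup>r\<^sup>+\<^sup>1 - v\<close>.\<close>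

section \<open>Free modules and dual codes\<close>

lemma vec_module_simps [simp]:
  "carrier (vec_module A n) = {..<n} \<rightarrow>\<^sub>E carrier A"
  "\<zero>\<^bsub>vec_module A n\<^esub> = (\<lambda>j\<in>{..<n}. \<zero>\<^bsub>A\<^esub>)"
  "x \<oplus>\<^bsub>vec_module A n\<^esub> y = (\<lambda>j\<in>{..<n}. x j \<oplus>\<^bsub>A\<^esub> y j)"
  "a \<odot>\<^bsub>vec_module A n\<^esub> x = (\<lambda>j\<in>{..<n}. a \<otimes>\<^bsub>A\<^esub> x j)"
  by (simp_all add: vec_module_def)

lemma (in cring) vec_module_is_module: "module R (vec_module R n)"
proof (rule moduleI)
  show "cring R" by (rule is_cring)
  show "abelian_group (vec_module R n)"
  proof (rule abelian_groupI)
    fix x assume x: "x \<in> carrier (vec_module R n)"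
    show "\<exists>y\<in>carrier (vec_module R n).
      y \<oplus>\<^bsub>vec_module R n\<^esub> x = \<zero>\<^bsub>vec_module R n\<^esub>"
      by (rule bexI[where x = "\<lambda>j\<in>{..<n}. \<ominus> x j"])
         (use x in \<open>auto simp: l_neg PiE_iff fun_eq_iff\<close>)
  qed (auto simp: PiE_iff fun_eq_iff extensional_def a_ac)
qed (auto simp: PiE_iff fun_eq_iff extensional_def l_distr r_distr m_assoc)

text \<open>Closure under scalars already yields the group structure: the zero vector is
  \<open>\<zero>\<close> times any member of the nonempty set, and negation is multiplication by
  \<open>\<ominus> \<one>\<close>.\<close>

lemma (in cring) submodule_vec_moduleI:
  assumes sub: "D \<subseteq> carrier (vec_module R n)"
    and ne: "D \<noteq> {}"
    and add: "\<And>x y. x \<in> D \<Longrightarrow> y \<in> D \<Longrightarrow> x \<oplus>\<^bsub>vec_module R n\<^esub> y \<in> D"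
    and smult: "\<And>a x. a \<in> carrier R \<Longrightarrow> x \<in> D \<Longrightarrow> a \<odot>\<^bsub>vec_module R n\<^esub> x \<in> D"
  shows "submodule D R (vec_module R n)"
proof -
  interpret M: module R "vec_module R n" by (rule vec_module_is_module)
  show ?thesis
  proof (rule M.submoduleI)
    from ne obtain x where "x \<in> D" by blast
    then show "\<zero>\<^bsub>vec_module R n\<^esub> \<in> D"
      using smult[OF zero_closed] M.smult_l_null sub by (metis subsetD)
  next
    fix x assume x: "x \<in> D"
    then have "\<ominus>\<^bsub>vec_module R n\<^esub> x = (\<ominus> \<one>) \<odot>\<^bsub>vec_module R n\<^esub> x"
      using M.smult_l_minus[of \<one> x] sub by (metis M.smult_one one_closed subsetD)
    then show "\<ominus>\<^bsub>vec_module R n\<^esub> x \<in> D" using smult[of "\<ominus> \<one>" x] x by simp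
  qed (use sub add smult in auto)
qed

lemma dual_code_iff:
  "y \<in> dual_code A n C \<longleftrightarrow> y \<in> {..<n} \<rightarrow>\<^sub>E carrier A \<and>
     (\<forall>c\<in>C. (\<Oplus>\<^bsub>A\<^esub>j\<in>{..<n}. y j \<otimes>\<^bsub>A\<^esub> c j) = \<zero>\<^bsub>A\<^esub>)"
  by (simp add: dual_code_def)

lemma (in cring) dual_code_add:
  assumes "C \<subseteq> {..<n} \<rightarrow>\<^sub>E carrier R" "x \<in> dual_code R n C" "y \<in> dual_code R n C"
  shows "(\<lambda>j\<in>{..<n}. x j \<oplus> y j) \<in> dual_code R n C"
proof -
  have x: "x j \<in> carrier R" and y: "y j \<in> carrier R" if "j < n" for j
    using assms(2,3) that by (auto simp: dual_code_iff PiE_iff)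
  have "(\<Oplus>j\<in>{..<n}. (\<lambda>j\<in>{..<n}. x j \<oplus> y j) j \<otimes> c j) = \<zero>" if c: "c \<in> C" for c
  proof -
    have c': "c j \<in> carrier R" if "j < n" for j
      using assms(1) c that by (auto simp: PiE_iff)
    have "(\<Oplus>j\<in>{..<n}. (\<lambda>j\<in>{..<n}. x j \<oplus> y j) j \<otimes> c j)
        = (\<Oplus>j\<in>{..<n}. x j \<otimes> c j \<oplus> y j \<otimes> c j)"
      by (rule finsum_cong') (auto simp: x y c' l_distr)
    also have "\<dots> = (\<Oplus>j\<in>{..<n}. x j \<otimes> c j) \<oplus> (\<Oplus>j\<in>{..<n}. y j \<otimes> c j)"
      by (rule finsum_addf) (auto simp: x y c')
    also have "\<dots> = \<zero>" using assms(2,3) c by (simp add: dual_code_iff)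
    finally show ?thesis .
  qed
  then show ?thesis by (auto simp: dual_code_iff x y)
qed

lemma (in cring) dual_code_smult:
  assumes "C \<subseteq> {..<n} \<rightarrow>\<^sub>E carrier R" "a \<in> carrier R" "x \<in> dual_code R n C"
  shows "(\<lambda>j\<in>{..<n}. a \<otimes> x j) \<in> dual_code R n C"
proof -
  have x: "x j \<in> carrier R" if "j < n" for j
    using assms(3) that by (auto simp: dual_code_iff PiE_iff)
  have "(\<Oplus>j\<in>{..<n}. (\<lambda>j\<in>{..<n}. a \<otimes> x j) j \<otimes> c j) = \<zero>" if c: "c \<in> C" for c
  proof -
    have c': "c j \<in> carrier R" if "j < n" for j
      using assms(1) c that by (auto simp: PiE_iff)
    have "(\<Oplus>j\<in>{..<n}. (\<lambda>j\<in>{..<n}. a \<otimes> x j) j \<otimes> c j)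
        = (\<Oplus>j\<in>{..<n}. a \<otimes> (x j \<otimes> c j))"
      by (rule finsum_cong') (auto simp: x c' assms(2) m_assoc)
    also have "\<dots> = a \<otimes> (\<Oplus>j\<in>{..<n}. x j \<otimes> c j)"
      by (rule finsum_rdistr[symmetric]) (auto simp: x c' assms(2))
    also have "\<dots> = \<zero>" using assms c by (simp add: dual_code_iff)
    finally show ?thesis .
  qed
  then show ?thesis by (auto simp: dual_code_iff x assms(2))
qed

lemma (in cring) zero_in_dual_code:
  assumes "C \<subseteq> {..<n} \<rightarrow>\<^sub>E carrier R"
  shows "(\<lambda>j\<in>{..<n}. \<zero>) \<in> dual_code R n C"
proof -
  have "(\<Oplus>j\<in>{..<n}. (\<lambda>j\<in>{..<n}. \<zero>) j \<otimes> c j) = \<zero>" if c: "c \<in> C" for c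
  proof -
    have "(\<Oplus>j\<in>{..<n}. (\<lambda>j\<in>{..<n}. \<zero>) j \<otimes> c j) = (\<Oplus>j\<in>{..<n}. \<zero>)"
      using assms c by (intro finsum_cong') (auto simp: PiE_iff)
    then show ?thesis by simp
  qed
  then show ?thesis by (auto simp: dual_code_iff)
qed

text \<open>Orthogonality to a given set of vectors is a linear condition, so \<open>C\<close> is an
  arbitrary set of vectors here. The result is applied to the three associated codes.\<close>

lemma (in cring) submodule_dual_code:
  assumes "C \<subseteq> {..<n} \<rightarrow>\<^sub>E carrier R"
  shows "submodule (dual_code R n C) R (vec_module R n)"
proof (rule submodule_vec_moduleI)
  show "dual_code R n C \<subseteq> carrier (vec_module R n)" by (auto simp: dual_code_def)
  show "dual_code R n C \<noteq> {}" using zero_in_dual_code[OF assms] by blast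
qed (simp_all add: dual_code_add dual_code_smult assms)

text \<open>Serves for the two trivial components when a single summand
  \<open>e\<^sub>i C\<^sub>i\<^sup>\<bottom>\<close> is viewed as a product of three
  submodules.\<close>

lemma (in cring) submodule_vec_zero:
  "submodule {\<lambda>j\<in>{..<n}. \<zero>} R (vec_module R n)"
  by (rule submodule_vec_moduleI) (auto intro!: restrict_ext)

section \<open>Codes over a product of three copies of a ring\<close>

text \<open>The map \<open>\<iota>\<close> identifies \<open>A\<close> with the product ring \<open>K \<times> K \<times> K\<close>.\<close>

locale triple_ring = K?: cring K + A?: cring A
  for K (structure) and A (structure) +
  fixes \<iota> :: "'a \<Rightarrow> 'a \<Rightarrow> 'a \<Rightarrow> 'c"
  assumes carrier_eq: "carrier A = {\<iota> a b c | a b c. a \<in> carrier K \<and> b \<in> carrier K \<and> c \<in> carrier K}"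
    and inj: "\<lbrakk>a \<in> carrier K; b \<in> carrier K; c \<in> carrier K;
        a' \<in> carrier K; b' \<in> carrier K; c' \<in> carrier K; \<iota> a b c = \<iota> a' b' c'\<rbrakk>
      \<Longrightarrow> a = a' \<and> b = b' \<and> c = c'"
    and add: "\<lbrakk>a \<in> carrier K; b \<in> carrier K; c \<in> carrier K;
        a' \<in> carrier K; b' \<in> carrier K; c' \<in> carrier K\<rbrakk>
      \<Longrightarrow> \<iota> a b c \<oplus>\<^bsub>A\<^esub> \<iota> a' b' c' = \<iota> (a \<oplus>\<^bsub>K\<^esub> a') (b \<oplus>\<^bsub>K\<^esub> b') (c \<oplus>\<^bsub>K\<^esub> c')"
    and mult: "\<lbrakk>a \<in> carrier K; b \<in> carrier K; c \<in> carrier K;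
        a' \<in> carrier K; b' \<in> carrier K; c' \<in> carrier K\<rbrakk>
      \<Longrightarrow> \<iota> a b c \<otimes>\<^bsub>A\<^esub> \<iota> a' b' c' = \<iota> (a \<otimes>\<^bsub>K\<^esub> a') (b \<otimes>\<^bsub>K\<^esub> b') (c \<otimes>\<^bsub>K\<^esub> c')"
begin

abbreviation vecs :: "nat \<Rightarrow> (nat \<Rightarrow> 'a) set"
  where "vecs n \<equiv> {..<n} \<rightarrow>\<^sub>E carrier K"

text \<open>The bijection of triples of vectors over \<open>K\<close> with vectors over
  \<open>A\<close> induced by \<iota>. For the idempotents of \<open>Rr\<close> it becomes
  \<open>comb_vec\<close>.\<close>

definition lift :: "nat \<Rightarrow> (nat \<Rightarrow> 'a) \<Rightarrow> (nat \<Rightarrow> 'a) \<Rightarrow> (nat \<Rightarrow> 'a) \<Rightarrow> nat \<Rightarrow> 'c"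
  where "lift n s t u = (\<lambda>j\<in>{..<n}. \<iota> (s j) (t j) (u j))"

abbreviation zero_vec :: "nat \<Rightarrow> nat \<Rightarrow> 'a"
  where "zero_vec n \<equiv> (\<lambda>j\<in>{..<n}. \<zero>\<^bsub>K\<^esub>)"

lemma closed [simp]:
  "\<lbrakk>a \<in> carrier K; b \<in> carrier K; c \<in> carrier K\<rbrakk> \<Longrightarrow> \<iota> a b c \<in> carrier A"
  by (auto simp: carrier_eq)

text \<open>By \<open>add\<close>, the left-hand side added to itself gives itself again;
  cancellation in the additive group of \<open>A\<close> leaves only zero.\<close>

lemma zero: "\<iota> \<zero>\<^bsub>K\<^esub> \<zero>\<^bsub>K\<^esub> \<zero>\<^bsub>K\<^esub> = \<zero>\<^bsub>A\<^esub>"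
  using add[of "\<zero>\<^bsub>K\<^esub>" "\<zero>\<^bsub>K\<^esub>" "\<zero>\<^bsub>K\<^esub>" "\<zero>\<^bsub>K\<^esub>" "\<zero>\<^bsub>K\<^esub>" "\<zero>\<^bsub>K\<^esub>"]
  by (simp add: A.add.l_cancel_one)

lemma finsum:
  assumes "finite I" "f \<in> I \<rightarrow> carrier K" "g \<in> I \<rightarrow> carrier K" "h \<in> I \<rightarrow> carrier K"
  shows "(\<Oplus>\<^bsub>A\<^esub>j\<in>I. \<iota> (f j) (g j) (h j))
    = \<iota> (\<Oplus>\<^bsub>K\<^esub>j\<in>I. f j) (\<Oplus>\<^bsub>K\<^esub>j\<in>I. g j) (\<Oplus>\<^bsub>K\<^esub>j\<in>I. h j)"
  using assms
proof (induction I rule: finite_induct)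
  case empty
  then show ?case by (simp add: zero)
next
  case (insert i I)
  then have "f i \<in> carrier K" "g i \<in> carrier K" "h i \<in> carrier K"
    "f \<in> I \<rightarrow> carrier K" "g \<in> I \<rightarrow> carrier K" "h \<in> I \<rightarrow> carrier K" by auto
  with insert show ?case
    by (subst A.finsum_insert) (auto simp: Pi_iff add)
qed

section \<open>Vectors over the product ring as triples of vectors\<close>

lemma lift_closed:
  "\<lbrakk>s \<in> vecs n; t \<in> vecs n; u \<in> vecs n\<rbrakk> \<Longrightarrow> lift n s t u \<in> {..<n} \<rightarrow>\<^sub>E carrier A"
  by (auto simp: lift_def PiE_iff)

lemma lift_surj:
  assumes "x \<in> {..<n} \<rightarrow>\<^sub>E carrier A"
  obtains s t u where "s \<in> vecs n" "t \<in> vecs n" "u \<in> vecs n" "x = lift n s t u"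
proof -
  have "\<forall>j\<in>{..<n}. \<exists>a b c. a \<in> carrier K \<and> b \<in> carrier K \<and> c \<in> carrier K \<and> x j = \<iota> a b c"
    using PiE_mem[OF assms] unfolding carrier_eq by blast
  then obtain f g h where fgh: "\<forall>j\<in>{..<n}. f j \<in> carrier K \<and> g j \<in> carrier K \<and> h j \<in> carrier K
      \<and> x j = \<iota> (f j) (g j) (h j)"
    unfolding bchoice_iff by blast
  show ?thesis
  proof (rule that)
    \<comment> \<open>The choice functions are arbitrary outside \<open>{..<n}\<close>; restricting
      them gives the extensional functions that \<open>vecs\<close> demands.\<close>
    show "restrict f {..<n} \<in> vecs n" "restrict g {..<n} \<in> vecs n" "restrict h {..<n} \<in> vecs n"
      using fgh by (simp_all add: PiE_iff)
    have "x \<in> extensional {..<n}" using assms by (simp add: PiE_iff)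
    then show "x = lift n (restrict f {..<n}) (restrict g {..<n}) (restrict h {..<n})"
      unfolding lift_def by (rule extensionalityI) (simp_all add: fgh)
  qed
qed

lemma lift_inj:
  assumes "s \<in> vecs n" "t \<in> vecs n" "u \<in> vecs n" "s' \<in> vecs n" "t' \<in> vecs n" "u' \<in> vecs n"
    and eq: "lift n s t u = lift n s' t' u'"
  shows "s = s' \<and> t = t' \<and> u = u'"
proof -
  have "s j = s' j \<and> t j = t' j \<and> u j = u' j" if j: "j < n" for j
    using fun_cong[OF eq, of j] assms(1-6) j by (intro inj) (auto simp: lift_def PiE_iff)
  then show ?thesis
    using assms(1-6) by (auto intro!: extensionalityI[of _ "{..<n}"] simp: PiE_iff)
qed

lemma lift_add:
  "\<lbrakk>s \<in> vecs n; t \<in> vecs n; u \<in> vecs n; s' \<in> vecs n; t' \<in> vecs n; u' \<in> vecs n\<rbrakk> \<Longrightarrow>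
    lift n s t u \<oplus>\<^bsub>vec_module A n\<^esub> lift n s' t' u'
      = lift n (\<lambda>j\<in>{..<n}. s j \<oplus>\<^bsub>K\<^esub> s' j) (\<lambda>j\<in>{..<n}. t j \<oplus>\<^bsub>K\<^esub> t' j) (\<lambda>j\<in>{..<n}. u j \<oplus>\<^bsub>K\<^esub> u' j)"
  by (auto simp: lift_def fun_eq_iff PiE_iff add)

lemma lift_smult:
  "\<lbrakk>a \<in> carrier K; b \<in> carrier K; c \<in> carrier K; s \<in> vecs n; t \<in> vecs n; u \<in> vecs n\<rbrakk> \<Longrightarrow>
    \<iota> a b c \<odot>\<^bsub>vec_module A n\<^esub> lift n s t u
      = lift n (\<lambda>j\<in>{..<n}. a \<otimes>\<^bsub>K\<^esub> s j) (\<lambda>j\<in>{..<n}. b \<otimes>\<^bsub>K\<^esub> t j) (\<lambda>j\<in>{..<n}. c \<otimes>\<^bsub>K\<^esub> u j)"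
  by (auto simp: lift_def fun_eq_iff PiE_iff mult)

lemma lift_decomp:
  assumes "s \<in> vecs n" "t \<in> vecs n" "u \<in> vecs n"
  shows "lift n s (zero_vec n) (zero_vec n) \<oplus>\<^bsub>vec_module A n\<^esub> lift n (zero_vec n) t (zero_vec n)
      \<oplus>\<^bsub>vec_module A n\<^esub> lift n (zero_vec n) (zero_vec n) u = lift n s t u"
  using assms by (auto simp: lift_def fun_eq_iff PiE_iff add)

text \<open>Since \<iota> respects sums and products, the inner product over \<open>A\<close> is
  \<iota> of the three inner products over \<open>K\<close>; injectivity and \<open>zero\<close>
  then separate the components.\<close>

lemma inner_product_lift_eq_zero_iff:
  assumes "s \<in> vecs n" "t \<in> vecs n" "u \<in> vecs n" "s' \<in> vecs n" "t' \<in> vecs n" "u' \<in> vecs n"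
  shows "(\<Oplus>\<^bsub>A\<^esub>j\<in>{..<n}. lift n s t u j \<otimes>\<^bsub>A\<^esub> lift n s' t' u' j) = \<zero>\<^bsub>A\<^esub> \<longleftrightarrow>
    (\<Oplus>\<^bsub>K\<^esub>j\<in>{..<n}. s j \<otimes>\<^bsub>K\<^esub> s' j) = \<zero>\<^bsub>K\<^esub> \<and> (\<Oplus>\<^bsub>K\<^esub>j\<in>{..<n}. t j \<otimes>\<^bsub>K\<^esub> t' j) = \<zero>\<^bsub>K\<^esub> \<and>
    (\<Oplus>\<^bsub>K\<^esub>j\<in>{..<n}. u j \<otimes>\<^bsub>K\<^esub> u' j) = \<zero>\<^bsub>K\<^esub>" (is "?l \<longleftrightarrow> ?a = _ \<and> ?b = _ \<and> ?c = _")
proof -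
  have cl: "s j \<in> carrier K" "t j \<in> carrier K" "u j \<in> carrier K"
    "s' j \<in> carrier K" "t' j \<in> carrier K" "u' j \<in> carrier K" if "j < n" for j
    using assms that by (auto simp: PiE_iff)
  have "(\<Oplus>\<^bsub>A\<^esub>j\<in>{..<n}. lift n s t u j \<otimes>\<^bsub>A\<^esub> lift n s' t' u' j)
      = (\<Oplus>\<^bsub>A\<^esub>j\<in>{..<n}. \<iota> (s j \<otimes>\<^bsub>K\<^esub> s' j) (t j \<otimes>\<^bsub>K\<^esub> t' j) (u j \<otimes>\<^bsub>K\<^esub> u' j))"
    by (rule A.finsum_cong') (auto simp: lift_def cl mult)
  also have "\<dots> = \<iota> ?a ?b ?c"
    by (rule finsum) (auto simp: cl)
  finally have eq: "?l \<longleftrightarrow> \<iota> ?a ?b ?c = \<iota> \<zero>\<^bsub>K\<^esub> \<zero>\<^bsub>K\<^esub> \<zero>\<^bsub>K\<^esub>" by (simp add: zero)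
  have "?a \<in> carrier K" "?b \<in> carrier K" "?c \<in> carrier K"
    by (auto intro!: K.finsum_closed simp: cl)
  then show ?thesis using inj[of ?a ?b ?c "\<zero>\<^bsub>K\<^esub>" "\<zero>\<^bsub>K\<^esub>" "\<zero>\<^bsub>K\<^esub>"] eq by auto
qed

text \<open>A scalar of \<open>A\<close> is a triple that acts by independent scalars of
  \<open>K\<close> on the three components, so each component only has to be stable under
  \<open>K\<close>.\<close>

lemma submodule_lift:
  assumes "submodule D1 K (vec_module K n)" "submodule D2 K (vec_module K n)"
    "submodule D3 K (vec_module K n)"
  shows "submodule {lift n s t u | s t u. s \<in> D1 \<and> t \<in> D2 \<and> u \<in> D3} A (vec_module A n)"
    (is "submodule ?D A ?M")
proof -
  interpret M: module K "vec_module K n" by (rule K.vec_module_is_module)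
  \<comment> \<open>Each instance contributes six facts, so corresponding facts about
    \<open>D1\<close>, \<open>D2\<close>, \<open>D3\<close> have indices that differ by 6 and
    12.\<close>
  note E = M.submoduleE[OF assms(1)] M.submoduleE[OF assms(2)] M.submoduleE[OF assms(3)]
  have sub: "s \<in> vecs n" if "s \<in> D1 \<union> D2 \<union> D3" for s using that E(1,7,13) by auto
  show ?thesis
  proof (rule A.submodule_vec_moduleI)
    show "?D \<subseteq> carrier ?M" using sub lift_closed by (simp add: subset_iff) blast
    show "?D \<noteq> {}" using E(2,8,14) by blast
  next
    fix x y assume "x \<in> ?D" "y \<in> ?D"
    then obtain s t u s' t' u' where D: "s \<in> D1" "t \<in> D2" "u \<in> D3" "s' \<in> D1" "t' \<in> D2" "u' \<in> D3"
      and xy: "x = lift n s t u" "y = lift n s' t' u'" by blast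
    have "x \<oplus>\<^bsub>?M\<^esub> y = lift n (s \<oplus>\<^bsub>vec_module K n\<^esub> s') (t \<oplus>\<^bsub>vec_module K n\<^esub> t')
        (u \<oplus>\<^bsub>vec_module K n\<^esub> u')" using lift_add[of s n t u s' t' u'] D sub by (simp add: xy)
    then show "x \<oplus>\<^bsub>?M\<^esub> y \<in> ?D"
      using E(5)[OF D(1,4)] E(11)[OF D(2,5)] E(17)[OF D(3,6)] by blast
  next
    fix d x assume "d \<in> carrier A" "x \<in> ?D"
    then obtain a b c s t u where abc: "a \<in> carrier K" "b \<in> carrier K" "c \<in> carrier K"
      and D: "s \<in> D1" "t \<in> D2" "u \<in> D3" and dx: "d = \<iota> a b c" "x = lift n s t u"
      unfolding carrier_eq by blast
    have "d \<odot>\<^bsub>?M\<^esub> x = lift n (a \<odot>\<^bsub>vec_module K n\<^esub> s) (b \<odot>\<^bsub>vec_module K n\<^esub> t)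
        (c \<odot>\<^bsub>vec_module K n\<^esub> u)" using lift_smult[of a b c s n t u] abc D sub by (simp add: dx)
    then show "d \<odot>\<^bsub>?M\<^esub> x \<in> ?D"
      using E(4)[OF abc(1) D(1)] E(10)[OF abc(2) D(2)] E(16)[OF abc(3) D(3)] by blast
  qed
qed

text \<open>The claimed decomposition for an abstract product ring. The dual code is first
  identified with the product of the three dual codes; \<open>lift_decomp\<close> then turns this
  product into a sum, and \<open>lift_inj\<close> makes the summands unique.\<close>

lemma dual_code_direct_sum:
  assumes C: "C \<subseteq> {..<n} \<rightarrow>\<^sub>E carrier A"
  defines "C1 \<equiv> {s \<in> vecs n. \<exists>t\<in>vecs n. \<exists>u\<in>vecs n. lift n s t u \<in> C}"
    and "C2 \<equiv> {t \<in> vecs n. \<exists>s\<in>vecs n. \<exists>u\<in>vecs n. lift n s t u \<in> C}"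
    and "C3 \<equiv> {u \<in> vecs n. \<exists>s\<in>vecs n. \<exists>t\<in>vecs n. lift n s t u \<in> C}"
  shows "internal_direct_sum3 A (vec_module A n) (dual_code A n C)
    ((\<lambda>s. lift n s (zero_vec n) (zero_vec n)) ` dual_code K n C1)
    ((\<lambda>t. lift n (zero_vec n) t (zero_vec n)) ` dual_code K n C2)
    ((\<lambda>u. lift n (zero_vec n) (zero_vec n) u) ` dual_code K n C3)"
    (is "internal_direct_sum3 A ?M _ ?D1 ?D2 ?D3")
proof -
  have sub: "C1 \<subseteq> vecs n" "C2 \<subseteq> vecs n" "C3 \<subseteq> vecs n" by (auto simp: C1_def C2_def C3_def)
  have dual_sub: "dual_code K n V \<subseteq> vecs n" for V by (auto simp: dual_code_def)
  \<comment> \<open>Written as products with the zero submodule in two places, the summands fall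
    under \<open>submodule_lift\<close>.\<close>
  have eqs: "?D1 = {lift n s t u | s t u. s \<in> dual_code K n C1 \<and> t \<in> {zero_vec n} \<and> u \<in> {zero_vec n}}"
    "?D2 = {lift n s t u | s t u. s \<in> {zero_vec n} \<and> t \<in> dual_code K n C2 \<and> u \<in> {zero_vec n}}"
    "?D3 = {lift n s t u | s t u. s \<in> {zero_vec n} \<and> t \<in> {zero_vec n} \<and> u \<in> dual_code K n C3}"
    by blast+
  have sm: "submodule ?D1 A ?M" "submodule ?D2 A ?M" "submodule ?D3 A ?M"
    unfolding eqs
    by (intro submodule_lift K.submodule_dual_code K.submodule_vec_zero sub)+
  have dual: "dual_code A n C = {lift n s t u | s t u.
      s \<in> dual_code K n C1 \<and> t \<in> dual_code K n C2 \<and> u \<in> dual_code K n C3}" (is "_ = ?R")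
  proof (rule Set.set_eqI)
    fix y
    show "y \<in> dual_code A n C \<longleftrightarrow> y \<in> ?R"
    proof
      assume y: "y \<in> dual_code A n C"
      then have "y \<in> {..<n} \<rightarrow>\<^sub>E carrier A" by (simp add: dual_code_iff)
      then obtain s t u where stu: "s \<in> vecs n" "t \<in> vecs n" "u \<in> vecs n" "y = lift n s t u"
        by (rule lift_surj)
      have orth: "(\<Oplus>\<^bsub>K\<^esub>j\<in>{..<n}. s j \<otimes>\<^bsub>K\<^esub> s' j) = \<zero>\<^bsub>K\<^esub> \<and>
          (\<Oplus>\<^bsub>K\<^esub>j\<in>{..<n}. t j \<otimes>\<^bsub>K\<^esub> t' j) = \<zero>\<^bsub>K\<^esub> \<and> (\<Oplus>\<^bsub>K\<^esub>j\<in>{..<n}. u j \<otimes>\<^bsub>K\<^esub> u' j) = \<zero>\<^bsub>K\<^esub>"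
        if "s' \<in> vecs n" "t' \<in> vecs n" "u' \<in> vecs n" "lift n s' t' u' \<in> C" for s' t' u'
        using y that(4) unfolding inner_product_lift_eq_zero_iff[OF stu(1-3) that(1-3), symmetric]
        by (simp add: dual_code_iff stu(4))
      \<comment> \<open>Membership in \<open>C1\<close> supplies the two missing components of a
        codeword with first component \<open>c\<close>; orthogonality of \<open>y\<close> to that
        codeword splits into three conditions, of which the first is the one wanted. The other two
        codes are treated alike.\<close>
      have "(\<Oplus>\<^bsub>K\<^esub>j\<in>{..<n}. s j \<otimes>\<^bsub>K\<^esub> c j) = \<zero>\<^bsub>K\<^esub>" if "c \<in> C1" for c
      proof -
        from that obtain t' u' where "c \<in> vecs n" "t' \<in> vecs n" "u' \<in> vecs n"
          "lift n c t' u' \<in> C" unfolding C1_def by blast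
        then show ?thesis using orth by blast
      qed
      then have s: "s \<in> dual_code K n C1" using stu(1) by (simp add: dual_code_iff)
      have "(\<Oplus>\<^bsub>K\<^esub>j\<in>{..<n}. t j \<otimes>\<^bsub>K\<^esub> c j) = \<zero>\<^bsub>K\<^esub>" if "c \<in> C2" for c
      proof -
        from that obtain s' u' where "c \<in> vecs n" "s' \<in> vecs n" "u' \<in> vecs n"
          "lift n s' c u' \<in> C" unfolding C2_def by blast
        then show ?thesis using orth by blast
      qed
      then have t: "t \<in> dual_code K n C2" using stu(2) by (simp add: dual_code_iff)
      have "(\<Oplus>\<^bsub>K\<^esub>j\<in>{..<n}. u j \<otimes>\<^bsub>K\<^esub> c j) = \<zero>\<^bsub>K\<^esub>" if "c \<in> C3" for c
      proof -
        from that obtain s' t' where "c \<in> vecs n" "s' \<in> vecs n" "t' \<in> vecs n"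
          "lift n s' t' c \<in> C" unfolding C3_def by blast
        then show ?thesis using orth by blast
      qed
      then have u: "u \<in> dual_code K n C3" using stu(3) by (simp add: dual_code_iff)
      show "y \<in> ?R" using stu(4) s t u by blast
    next
      assume "y \<in> ?R"
      then obtain s t u where y: "y = lift n s t u" and stu:
        "s \<in> dual_code K n C1" "t \<in> dual_code K n C2" "u \<in> dual_code K n C3" by blast
      have v: "s \<in> vecs n" "t \<in> vecs n" "u \<in> vecs n" using stu dual_sub by blast+
      have "(\<Oplus>\<^bsub>A\<^esub>j\<in>{..<n}. y j \<otimes>\<^bsub>A\<^esub> c j) = \<zero>\<^bsub>A\<^esub>" if c: "c \<in> C" for c
      proof -
        obtain s' t' u' where v': "s' \<in> vecs n" "t' \<in> vecs n" "u' \<in> vecs n" and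
          c': "c = lift n s' t' u'" using lift_surj[OF subsetD[OF C c]] .
        \<comment> \<open>For each component of a codeword, the other two components are the
          witnesses that the associated code asks for.\<close>
        have "s' \<in> C1" "t' \<in> C2" "u' \<in> C3" using v' c c' unfolding C1_def C2_def C3_def by blast+
        then show ?thesis
          using stu by (simp add: y c' inner_product_lift_eq_zero_iff[OF v v'] dual_code_iff)
      qed
      then show "y \<in> dual_code A n C" using lift_closed[OF v] by (simp add: dual_code_iff y)
    qed
  qed
  have sum: "dual_code A n C = ?D1 <+>\<^bsub>?M\<^esub> ?D2 <+>\<^bsub>?M\<^esub> ?D3"
  proof -
    have "?D1 <+>\<^bsub>?M\<^esub> ?D2 <+>\<^bsub>?M\<^esub> ?D3 =
      (\<Union>s\<in>dual_code K n C1. \<Union>t\<in>dual_code K n C2. \<Union>u\<in>dual_code K n C3.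
        {lift n s (zero_vec n) (zero_vec n) \<oplus>\<^bsub>?M\<^esub> lift n (zero_vec n) t (zero_vec n)
          \<oplus>\<^bsub>?M\<^esub> lift n (zero_vec n) (zero_vec n) u})"
      \<comment> \<open>The vector addition has to stay folded, because \<open>lift_decomp\<close>
        is applied to it in the next step.\<close>
      by (simp add: set_add_def' del: vec_module_simps)
    also have "\<dots> = (\<Union>s\<in>dual_code K n C1. \<Union>t\<in>dual_code K n C2. \<Union>u\<in>dual_code K n C3.
        {lift n s t u})"
      by (intro SUP_cong refl arg_cong[of _ _ "\<lambda>x. {x}"] lift_decomp subsetD[OF dual_sub])
    also have "\<dots> = dual_code A n C"
      unfolding dual by blast
    finally show ?thesis ..
  qed
  have uniq: "x = x' \<and> y = y' \<and> z = z'"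
    if D: "x \<in> ?D1" "y \<in> ?D2" "z \<in> ?D3" "x' \<in> ?D1" "y' \<in> ?D2" "z' \<in> ?D3"
      and eq: "x \<oplus>\<^bsub>?M\<^esub> y \<oplus>\<^bsub>?M\<^esub> z = x' \<oplus>\<^bsub>?M\<^esub> y' \<oplus>\<^bsub>?M\<^esub> z'" for x y z x' y' z'
  proof -
    obtain s t u where stu: "s \<in> vecs n" "t \<in> vecs n" "u \<in> vecs n"
      and xyz: "x = lift n s (zero_vec n) (zero_vec n)" "y = lift n (zero_vec n) t (zero_vec n)"
        "z = lift n (zero_vec n) (zero_vec n) u"
      using D(1-3) dual_sub by blast
    obtain s' t' u' where stu': "s' \<in> vecs n" "t' \<in> vecs n" "u' \<in> vecs n"
      and xyz': "x' = lift n s' (zero_vec n) (zero_vec n)" "y' = lift n (zero_vec n) t' (zero_vec n)"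
        "z' = lift n (zero_vec n) (zero_vec n) u'"
      using D(4-6) dual_sub by blast
    have "lift n s t u = lift n s' t' u'"
      using eq by (simp only: xyz xyz' lift_decomp stu stu')
    from lift_inj[OF stu stu' this] show ?thesis by (simp add: xyz xyz')
  qed
  show ?thesis
    unfolding internal_direct_sum3_def using sm sum uniq by blast
qed

end

section \<open>Orthogonal idempotents\<close>

text \<open>If the multiple vanished, the additive order of \<open>\<one>\<close> would divide both
  \<open>n\<close> and the order of the additive group, hence be 1, which forces
  \<open>\<one> = \<zero>\<close>.\<close>

lemma (in ring) add_pow_one_neq_zero:
  assumes "finite (carrier R)" "coprime n (card (carrier R))" "\<one> \<noteq> \<zero>"
  shows "[n] \<cdot> \<one> \<noteq> \<zero>"
proof
  assume n: "[n] \<cdot> \<one> = \<zero>"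
  have "add.ord \<one> dvd n"
    using n add.pow_eq_id[of \<one> n] by (simp add: add_pow_def)
  moreover have "add.ord \<one> dvd card (carrier R)"
    using add.ord_dvd_group_order[of \<one>] by (simp add: order_def)
  ultimately have "add.ord \<one> = 1"
    using assms(2) by (metis coprime_common_divisor_nat nat_dvd_1_iff_1)
  then show False using add.ord_eq_1[of \<one>] assms(3) by simp
qed

section \<open>Power sums and idempotents from an element with
  \<open>v [^] Suc r = v\<close>\<close>

lemma (in cring) power_sum_Suc:
  assumes "v \<in> carrier R"
  shows "(\<Oplus>i\<in>{1..Suc m}. v [^] i) = v [^] Suc m \<oplus> (\<Oplus>i\<in>{1..m}. v [^] i)"
proof -
  have "(\<Oplus>i\<in>insert (Suc m) {1..m}. v [^] i) = v [^] Suc m \<oplus> (\<Oplus>i\<in>{1..m}. v [^] i)"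
    using assms by (intro finsum_insert) auto
  moreover have "insert (Suc m) {1..m} = {1..Suc m}" by auto
  ultimately show ?thesis by simp
qed

text \<open>Multiplication by \<open>v\<close> shifts the sum by one exponent. The two boundary
  terms stand on opposite sides, which avoids subtraction.\<close>

lemma (in cring) power_sum_shift:
  assumes v: "v \<in> carrier R"
  shows "v \<otimes> (\<Oplus>i\<in>{1..m}. v [^] i) \<oplus> v = (\<Oplus>i\<in>{1..m}. v [^] i) \<oplus> v [^] Suc m"
proof (induction m)
  case 0
  show ?case using v by simp
next
  case (Suc m)
  let ?s = "\<Oplus>i\<in>{1..m}. v [^] i"
  have s: "?s \<in> carrier R" using v by (intro finsum_closed) auto
  have "v \<otimes> (v [^] Suc m \<oplus> ?s) \<oplus> v = v \<otimes> v [^] Suc m \<oplus> (v \<otimes> ?s \<oplus> v)"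
    using v s by (simp add: r_distr a_assoc)
  also have "\<dots> = (v [^] Suc m \<oplus> ?s) \<oplus> v [^] Suc (Suc m)"
    unfolding Suc.IH using v s by (simp add: a_ac m_comm)
  finally show ?case unfolding power_sum_Suc[OF v] .
qed

text \<open>The boundary terms of the shift coincide when \<open>v [^] Suc r = v\<close>, so they
  cancel: multiplication by \<open>v\<close> permutes the summands cyclically.\<close>

lemma (in cring) power_sum_absorb:
  assumes v: "v \<in> carrier R" and r: "v [^] Suc r = v"
  shows "v \<otimes> (\<Oplus>i\<in>{1..r}. v [^] i) = (\<Oplus>i\<in>{1..r}. v [^] i)"
proof -
  have "(\<Oplus>i\<in>{1..r}. v [^] i) \<in> carrier R" using v by (intro finsum_closed) auto
  then show ?thesis
    using power_sum_shift[OF v, of r] v unfolding r by (simp add: add.r_cancel)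
qed

lemma (in cring) absorb_power:
  assumes "v \<in> carrier R" "x \<in> carrier R" "v \<otimes> x = x"
  shows "v [^] (k :: nat) \<otimes> x = x"
  using assms by (induction k) (simp_all add: m_assoc)

text \<open>Because \<open>v\<close> fixes \<open>e\<close>, every power of \<open>v\<close> fixes
  \<open>e\<close>, and the sum of \<open>r\<close> powers acts on \<open>e\<close> as
  multiplication by \<open>r\<close>. The factor \<open>c\<close>, an inverse of \<open>r\<close>,
  compensates for this.\<close>

lemma (in cring) power_sum_idempotent:
  assumes v: "v \<in> carrier R" and r: "v [^] Suc r = v"
    and c: "c \<in> carrier R" "c \<otimes> [r] \<cdot> \<one> = \<one>"
  defines "e \<equiv> c \<otimes> (\<Oplus>i\<in>{1..r}. v [^] i)"
  shows "v \<otimes> e = e" "e \<otimes> e = e"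
proof -
  let ?s = "\<Oplus>i\<in>{1..r}. v [^] i"
  have s: "?s \<in> carrier R" using v by (intro finsum_closed) auto
  then have e: "e \<in> carrier R" using c by (simp add: e_def)
  show ve: "v \<otimes> e = e"
    unfolding e_def using power_sum_absorb[OF v r] v c s by (simp add: m_lcomm)
  have "?s \<otimes> e = (\<Oplus>i\<in>{1..r}. v [^] i \<otimes> e)"
    using v e by (intro finsum_ldistr) auto
  also have "\<dots> = (\<Oplus>i\<in>{1..r}. e)"
    using v e by (intro finsum_cong') (auto simp: absorb_power[OF v e ve])
  also have "\<dots> = [r] \<cdot> e"
    using add.finprod_const[OF e, of "{1..r}"] by simp
  finally have "e \<otimes> e = c \<otimes> ([r] \<cdot> e)"
    using c s e by (simp add: e_def m_assoc)
  also have "\<dots> = (c \<otimes> [r] \<cdot> \<one>) \<otimes> e"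
    using c(1) e add_pow_ldistr[of \<one> e r] by (simp add: m_assoc)
  finally show "e \<otimes> e = e" using c e by simp
qed

text \<open>The exponent \<open>2r\<close> is regrouped as \<open>(r - 1) + (r + 1)\<close>, and the
  second power collapses to \<open>v\<close>. Positivity of \<open>r\<close> provides the
  predecessor.\<close>

lemma (in cring) power_idempotent:
  assumes "v \<in> carrier R" "v [^] Suc r = v" "r > 0"
  shows "v [^] r \<otimes> v [^] r = v [^] r"
proof -
  obtain m where m: "r = Suc m" using assms(3) by (cases r) auto
  have "v [^] r \<otimes> v [^] r = v [^] m \<otimes> v [^] Suc r"
    using assms(1) by (simp only: nat_pow_mult m) (simp only: add_Suc add_Suc_right)
  also have "\<dots> = v [^] r" using assms(1,2) by (simp add: m)
  finally show ?thesis .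
qed

text \<open>Orthogonality makes \<iota> multiplicative, and multiplying by one of the idempotents
  isolates the corresponding coefficient, which gives injectivity.\<close>

lemma (in cring) idempotents_triple_ring:
  fixes K (structure)
  assumes K: "field K" and h: "h \<in> ring_hom K R"
    and f: "f1 \<in> carrier R" "f2 \<in> carrier R" "f3 \<in> carrier R"
    and idem: "f1 \<otimes> f1 = f1" "f2 \<otimes> f2 = f2" "f3 \<otimes> f3 = f3"
    and orth: "f1 \<otimes> f2 = \<zero>" "f1 \<otimes> f3 = \<zero>" "f2 \<otimes> f3 = \<zero>"
    and sum: "f1 \<oplus> f2 \<oplus> f3 = \<one>"
    and nz: "f1 \<noteq> \<zero>" "f2 \<noteq> \<zero>" "f3 \<noteq> \<zero>"
  defines "\<iota> \<equiv> \<lambda>a b c. f1 \<otimes> h a \<oplus> f2 \<otimes> h b \<oplus> f3 \<otimes> h c"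
  shows "triple_ring K (R \<lparr>carrier := {\<iota> a b c | a b c.
    a \<in> carrier K \<and> b \<in> carrier K \<and> c \<in> carrier K}\<rparr>) \<iota>"
proof -
  interpret K: field K by (rule K)
  interpret H: ring_hom_cring K R h
    by (intro ring_hom_cring.intro ring_hom_cring_axioms.intro K.is_cring is_cring h)
  let ?S = "{\<iota> a b c | a b c. a \<in> carrier K \<and> b \<in> carrier K \<and> c \<in> carrier K}"
  have orth': "f2 \<otimes> f1 = \<zero>" "f3 \<otimes> f1 = \<zero>" "f3 \<otimes> f2 = \<zero>"
    using orth f by (simp_all add: m_comm)
  note [simp] = f idem orth orth'
  have cl [simp]: "\<iota> a b c \<in> carrier R" if "a \<in> carrier K" "b \<in> carrier K" "c \<in> carrier K" for a b c
    using that by (simp add: \<iota>_def)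
  have add: "\<iota> a b c \<oplus> \<iota> a' b' c' = \<iota> (a \<oplus>\<^bsub>K\<^esub> a') (b \<oplus>\<^bsub>K\<^esub> b') (c \<oplus>\<^bsub>K\<^esub> c')"
    if "a \<in> carrier K" "b \<in> carrier K" "c \<in> carrier K"
      "a' \<in> carrier K" "b' \<in> carrier K" "c' \<in> carrier K" for a b c a' b' c'
    using that by (simp add: \<iota>_def r_distr a_ac)
  \<comment> \<open>Bringing the two idempotents together lets the six cross terms of the product
    below vanish and the three squares collapse.\<close>
  have swap: "(x \<otimes> h a) \<otimes> (y \<otimes> h b) = (x \<otimes> y) \<otimes> h (a \<otimes>\<^bsub>K\<^esub> b)"
    if "x \<in> carrier R" "y \<in> carrier R" "a \<in> carrier K" "b \<in> carrier K" for x y a b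
    using that by (simp add: m_ac)
  have mult: "\<iota> a b c \<otimes> \<iota> a' b' c' = \<iota> (a \<otimes>\<^bsub>K\<^esub> a') (b \<otimes>\<^bsub>K\<^esub> b') (c \<otimes>\<^bsub>K\<^esub> c')"
    if "a \<in> carrier K" "b \<in> carrier K" "c \<in> carrier K"
      "a' \<in> carrier K" "b' \<in> carrier K" "c' \<in> carrier K" for a b c a' b' c'
    using that by (simp add: \<iota>_def r_distr l_distr swap del: H.hom_mult)
  have one: "\<iota> \<one>\<^bsub>K\<^esub> \<one>\<^bsub>K\<^esub> \<one>\<^bsub>K\<^esub> = \<one>" using sum by (simp add: \<iota>_def)
  have "subring ?S R"
  proof (rule ring.subringI[OF ring_axioms])
    show "?S \<subseteq> carrier R" by auto
    show "\<one> \<in> ?S" using one[symmetric] by blast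
    show "x \<oplus> y \<in> ?S" "x \<otimes> y \<in> ?S" if "x \<in> ?S" "y \<in> ?S" for x y
      using that add mult K.add.m_closed K.m_closed by (auto, metis+)
    fix x assume "x \<in> ?S"
    then obtain a b c where abc: "a \<in> carrier K" "b \<in> carrier K" "c \<in> carrier K" "x = \<iota> a b c" by blast
    have "\<iota> (\<ominus>\<^bsub>K\<^esub> a) (\<ominus>\<^bsub>K\<^esub> b) (\<ominus>\<^bsub>K\<^esub> c) \<oplus> x = \<iota> \<zero>\<^bsub>K\<^esub> \<zero>\<^bsub>K\<^esub> \<zero>\<^bsub>K\<^esub>"
      using abc by (simp add: add K.l_neg)
    also have "\<dots> = \<zero>" by (simp add: \<iota>_def)
    finally have "\<ominus> x = \<iota> (\<ominus>\<^bsub>K\<^esub> a) (\<ominus>\<^bsub>K\<^esub> b) (\<ominus>\<^bsub>K\<^esub> c)"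
      using abc by (simp add: minus_equality)
    then show "\<ominus> x \<in> ?S" using abc K.a_inv_closed by blast
  qed
  then have cring: "cring (R \<lparr>carrier := ?S\<rparr>)"
    using subcring_iff subcringI' subringE(1) by blast
  \<comment> \<open>Here \<open>K\<close> has to be a field: a nonzero difference of coefficients
    would be a unit whose image annihilates \<open>f\<close>, and multiplying by the image of its
    inverse would give \<open>f = \<zero>\<close>.\<close>
  have comp: "a = a'" if "f \<in> carrier R" "f \<noteq> \<zero>" "f \<otimes> h a = f \<otimes> h a'"
    "a \<in> carrier K" "a' \<in> carrier K" for f a a'
  proof (rule ccontr)
    assume "a \<noteq> a'"
    then have d: "a \<ominus>\<^bsub>K\<^esub> a' \<in> Units K" using that(4,5) by (simp add: K.field_Units)
    have "f \<otimes> h (a \<ominus>\<^bsub>K\<^esub> a') = \<zero>"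
      using that by (simp add: K.minus_eq r_distr r_minus r_neg)
    then have "f \<otimes> (h (a \<ominus>\<^bsub>K\<^esub> a') \<otimes> h (inv\<^bsub>K\<^esub> (a \<ominus>\<^bsub>K\<^esub> a'))) = \<zero>"
      using that(1) d K.Units_closed by (simp flip: m_assoc)
    also have "h (a \<ominus>\<^bsub>K\<^esub> a') \<otimes> h (inv\<^bsub>K\<^esub> (a \<ominus>\<^bsub>K\<^esub> a')) = \<one>"
      using d K.Units_closed by (simp flip: H.hom_mult)
    finally show False using that(1,2) by simp
  qed
  have proj: "f1 \<otimes> \<iota> a b c = f1 \<otimes> h a" "f2 \<otimes> \<iota> a b c = f2 \<otimes> h b" "f3 \<otimes> \<iota> a b c = f3 \<otimes> h c"
    if "a \<in> carrier K" "b \<in> carrier K" "c \<in> carrier K" for a b c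
    using that by (simp_all add: \<iota>_def r_distr flip: m_assoc)
  have inj: "a = a' \<and> b = b' \<and> c = c'"
    if "a \<in> carrier K" "b \<in> carrier K" "c \<in> carrier K"
      "a' \<in> carrier K" "b' \<in> carrier K" "c' \<in> carrier K" "\<iota> a b c = \<iota> a' b' c'" for a b c a' b' c'
    using that proj[of a b c] proj[of a' b' c'] comp f nz by metis
  show ?thesis
    by (intro triple_ring.intro triple_ring_axioms.intro cring K.is_cring)
      (simp, rule inj, assumption+, simp add: add, simp add: mult)
qed

section \<open>The idempotents of the quotient ring\<close>

text \<open>Isolates what the computations in the quotient use about \<open>r\<close>: it exceeds 1
  and is invertible in \<open>K\<close>.\<close>

locale Rr_ring = field K for K (structure) +
  fixes r :: nat
  assumes r_gt_one: "r > 1" and r_neq_zero: "[r] \<cdot> \<one> \<noteq> \<zero>"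
begin

lemma r_pos: "r > 0"
  using r_gt_one by simp

abbreviation P where "P \<equiv> poly_ring K"
abbreviation S where "S \<equiv> Rr K r"

sublocale P: domain P
  by (rule univ_poly_is_domain[OF carrier_is_subring])

lemma X_closed: "X \<in> carrier P"
  by (rule var_closed[OF carrier_is_subring])

lemma Rr_poly_closed: "Rr_poly K r \<in> carrier P"
  using X_closed by (simp add: Rr_poly_def)

sublocale I: ideal "PIdl\<^bsub>P\<^esub> (Rr_poly K r)" P
  by (rule P.cgenideal_ideal[OF Rr_poly_closed])

sublocale S: cring S
  unfolding Rr_def rupture_def by (rule I.quotient_is_cring[OF P.is_cring])

sublocale Q: ring_hom_cring P S "Rr_class K r"
proof (intro ring_hom_cring.intro ring_hom_cring_axioms.intro P.is_cring S.is_cring)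
  have "Rr_class K r = (\<lambda>q. PIdl\<^bsub>P\<^esub> (Rr_poly K r) +>\<^bsub>P\<^esub> q)" by (simp add: Rr_class_def fun_eq_iff)
  then show "Rr_class K r \<in> ring_hom P S"
    unfolding Rr_def by (simp add: rupture_surj_hom(1)[OF carrier_is_subring Rr_poly_closed])
qed

sublocale C: ring_hom_cring K S "Rr_const K r"
proof (intro ring_hom_cring.intro ring_hom_cring_axioms.intro is_cring S.is_cring)
  have "Rr_const K r = Rr_class K r \<circ> poly_of_const" by (simp add: Rr_const_def fun_eq_iff)
  then show "Rr_const K r \<in> ring_hom K S"
    using ring_hom_trans[OF canonical_embedding_is_hom[OF carrier_is_subring] Q.homh] by simp
qed

section \<open>Detecting nonzero classes by evaluation and by degree\<close>

lemma Rr_class_eq_zero_iff: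
  assumes "q \<in> carrier P"
  shows "Rr_class K r q = \<zero>\<^bsub>S\<^esub> \<longleftrightarrow> (\<exists>g\<in>carrier P. q = g \<otimes>\<^bsub>P\<^esub> Rr_poly K r)"
proof -
  have "Rr_class K r q = \<zero>\<^bsub>S\<^esub> \<longleftrightarrow> PIdl\<^bsub>P\<^esub> (Rr_poly K r) +>\<^bsub>P\<^esub> q = PIdl\<^bsub>P\<^esub> (Rr_poly K r)"
    by (simp add: Rr_class_def Rr_def rupture_def FactRing_def)
  also have "\<dots> \<longleftrightarrow> q \<in> PIdl\<^bsub>P\<^esub> (Rr_poly K r)"
    using I.rcos_const_imp_mem[OF assms] P.a_rcos_zero[OF I.ideal_axioms] by blast
  also have "\<dots> \<longleftrightarrow> (\<exists>g\<in>carrier P. q = g \<otimes>\<^bsub>P\<^esub> Rr_poly K r)"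
    unfolding cgenideal_def by blast
  finally show ?thesis .
qed

lemma v_closed: "Rr_v K r \<in> carrier S"
  unfolding Rr_v_def using X_closed by (rule Q.hom_closed)

lemma v_pow: "Rr_v K r [^]\<^bsub>S\<^esub> (i :: nat) = Rr_class K r (X [^]\<^bsub>P\<^esub> i)"
  unfolding Rr_v_def by (rule Q.hom_pow[OF X_closed, symmetric])

lemma v_pow_Suc_r: "Rr_v K r [^]\<^bsub>S\<^esub> Suc r = Rr_v K r"
proof -
  have "Rr_class K r (Rr_poly K r) = \<zero>\<^bsub>S\<^esub>"
    using Rr_class_eq_zero_iff[OF Rr_poly_closed] Rr_poly_closed by (metis P.l_one P.one_closed)
  then have "Rr_v K r [^]\<^bsub>S\<^esub> Suc r \<ominus>\<^bsub>S\<^esub> Rr_v K r = \<zero>\<^bsub>S\<^esub>"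
    unfolding v_pow Rr_v_def using X_closed
    by (simp add: Rr_poly_def P.minus_eq S.minus_eq del: P.nat_pow_Suc)
  then show ?thesis using v_closed by (simp del: S.nat_pow_Suc)
qed

lemma eval_hom:
  assumes "a \<in> carrier K"
  shows "ring_hom_cring P K (\<lambda>q. eval q a)"
  by (rule eval_cring_hom[OF carrier_is_subring assms])

lemma eval_X_pow:
  assumes "a \<in> carrier K"
  shows "eval (X [^]\<^bsub>P\<^esub> (i :: nat)) a = a [^] i"
proof -
  interpret E: ring_hom_cring P K "\<lambda>q. eval q a" by (rule eval_hom[OF assms])
  show ?thesis using E.hom_pow[OF X_closed] assms by (simp add: eval_var)
qed

text \<open>The condition on \<open>a\<close> says that \<open>a\<close> is a root of
  \<open>Rr_poly\<close>, so evaluation at \<open>a\<close> kills the whole ideal and descends to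
  the quotient. It is used at \<open>\<one>\<close> and at \<open>\<zero>\<close>.\<close>

lemma eval_eq_zero:
  assumes q: "q \<in> carrier P" "Rr_class K r q = \<zero>\<^bsub>S\<^esub>"
    and a: "a \<in> carrier K" "a [^] Suc r = a"
  shows "eval q a = \<zero>"
proof -
  interpret E: ring_hom_cring P K "\<lambda>q. eval q a" by (rule eval_hom[OF a(1)])
  obtain g where g: "g \<in> carrier P" "q = g \<otimes>\<^bsub>P\<^esub> Rr_poly K r"
    using q Rr_class_eq_zero_iff by blast
  have "eval (Rr_poly K r) a = a [^] Suc r \<ominus> a"
    using a(1) X_closed
    by (simp add: Rr_poly_def P.minus_eq minus_eq eval_X_pow eval_var del: P.nat_pow_Suc nat_pow_Suc)
  also have "\<dots> = \<zero>" unfolding a(2) using a(1) by (simp add: minus_eq r_neg)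
  finally show ?thesis using g Rr_poly_closed by simp
qed

lemma degree_X_pow_minus_X:
  assumes "m > 1"
  shows "degree (X [^]\<^bsub>P\<^esub> m \<ominus>\<^bsub>P\<^esub> X) = m"
proof -
  have "degree (X [^]\<^bsub>P\<^esub> m) = m"
    unfolding unitary_monom_eq_var_pow[OF carrier_is_subring, symmetric] by (simp add: monom_def)
  moreover have "degree (\<ominus>\<^bsub>P\<^esub> X) = 1"
    using univ_poly_a_inv_degree[OF carrier_is_subring X_closed] by (simp add: var_def)
  moreover have "polynomial (carrier K) (X [^]\<^bsub>P\<^esub> m)" "polynomial (carrier K) (\<ominus>\<^bsub>P\<^esub> X)"
    using X_closed by (simp_all add: univ_poly_carrier)
  ultimately show ?thesis
    using poly_add_degree_eq[OF carrier_is_subring, of "X [^]\<^bsub>P\<^esub> m" "\<ominus>\<^bsub>P\<^esub> X"] assms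
    by (simp add: P.minus_eq univ_poly_add)
qed

lemma v_square_neq_v:
  shows "Rr_v K r \<otimes>\<^bsub>S\<^esub> Rr_v K r \<noteq> Rr_v K r"
proof
  assume eq: "Rr_v K r \<otimes>\<^bsub>S\<^esub> Rr_v K r = Rr_v K r"
  let ?q = "X [^]\<^bsub>P\<^esub> (2 :: nat) \<ominus>\<^bsub>P\<^esub> X"
  have q: "?q \<in> carrier P" using X_closed by simp
  have "Rr_class K r ?q = Rr_v K r [^]\<^bsub>S\<^esub> (2 :: nat) \<ominus>\<^bsub>S\<^esub> Rr_v K r"
    unfolding v_pow using X_closed by (simp add: P.minus_eq S.minus_eq Rr_v_def)
  also have "\<dots> = \<zero>\<^bsub>S\<^esub>"
    using eq v_closed by (simp add: numeral_2_eq_2 S.minus_eq S.r_neg)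
  finally have "Rr_poly K r pdivides ?q"
    unfolding pdivides_def factor_def using Rr_class_eq_zero_iff[OF q] Rr_poly_closed
    by (auto simp: P.m_comm)
  moreover have "degree ?q = 2" by (rule degree_X_pow_minus_X) simp
  \<comment> \<open>The zero polynomial is the empty list and is divisible by everything, so
    comparing degrees along the divisibility requires \<open>?q\<close> to be nonzero.\<close>
  moreover from this have "?q \<noteq> []" by auto
  moreover have "degree (Rr_poly K r) = r + 1"
    unfolding Rr_poly_def using r_pos by (intro degree_X_pow_minus_X) simp
  ultimately show False
    using pdivides_imp_degree_le[OF carrier_is_subring Rr_poly_closed q] r_gt_one by simp
qed

section \<open>The relations between the three idempotents\<close>

lemma inv_nat: "inv_nat K r \<in> carrier K" "inv_nat K r \<otimes> [r] \<cdot> \<one> = \<one>"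
  using r_neq_zero by (simp_all add: inv_nat_def field_Units)

lemma power_sum_closed: "(\<Oplus>\<^bsub>S\<^esub>i\<in>{1..m :: nat}. Rr_v K r [^]\<^bsub>S\<^esub> i) \<in> carrier S"
  using v_closed by (intro S.finsum_closed) auto

lemma e1_closed: "e1 K r \<in> carrier S"
  unfolding e1_def by (intro S.m_closed power_sum_closed C.hom_closed inv_nat)

lemma e2_closed: "e2 K r \<in> carrier S"
  unfolding e2_def
  by (intro S.a_closed S.a_inv_closed S.m_closed power_sum_closed C.hom_closed
      add.nat_pow_closed inv_nat S.nat_pow_closed v_closed)

lemma e3_closed: "e3 K r \<in> carrier S"
  unfolding e3_def using v_closed by simp

lemma triple_ring_Rsub:
  "triple_ring K (Rsub K r)
    (\<lambda>a b c. e1 K r \<otimes>\<^bsub>S\<^esub> Rr_const K r a \<oplus>\<^bsub>S\<^esub> e2 K r \<otimes>\<^bsub>S\<^esub> Rr_const K r b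
       \<oplus>\<^bsub>S\<^esub> e3 K r \<otimes>\<^bsub>S\<^esub> Rr_const K r c)"
proof -
  let ?v = "Rr_v K r"
  let ?w = "?v [^]\<^bsub>S\<^esub> r"
  let ?c = "inv_nat K r"
  note c = inv_nat and e1c = e1_closed and e2c = e2_closed and e3c = e3_closed
  let ?d = "Rr_const K r ?c"
  \<comment> \<open>Carries the coefficients \<open>1/r\<close> and \<open>(r - 1)/r\<close> over to
    multiples of \<open>?d\<close> in the quotient.\<close>
  have add_pow_hom: "Rr_const K r ([m] \<cdot> x) = [m] \<cdot>\<^bsub>S\<^esub> Rr_const K r x" if "x \<in> carrier K" for m :: nat and x
    using that by (induction m) simp_all
  have d: "?d \<in> carrier S" "?d \<otimes>\<^bsub>S\<^esub> [r] \<cdot>\<^bsub>S\<^esub> \<one>\<^bsub>S\<^esub> = \<one>\<^bsub>S\<^esub>"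
  proof -
    show "?d \<in> carrier S" using c by simp
    have "?d \<otimes>\<^bsub>S\<^esub> [r] \<cdot>\<^bsub>S\<^esub> \<one>\<^bsub>S\<^esub> = Rr_const K r (?c \<otimes> [r] \<cdot> \<one>)"
      using c(1) add_pow_hom[of \<one> r] by simp
    then show "?d \<otimes>\<^bsub>S\<^esub> [r] \<cdot>\<^bsub>S\<^esub> \<one>\<^bsub>S\<^esub> = \<one>\<^bsub>S\<^esub>" unfolding c(2) by simp
  qed
  note v = v_closed and w = S.nat_pow_closed[OF v_closed, of r]
  have ve1: "?v \<otimes>\<^bsub>S\<^esub> e1 K r = e1 K r" and e1e1: "e1 K r \<otimes>\<^bsub>S\<^esub> e1 K r = e1 K r"
    using S.power_sum_idempotent[OF v v_pow_Suc_r d] by (simp_all add: e1_def)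
  have ww: "?w \<otimes>\<^bsub>S\<^esub> ?w = ?w"
    by (rule S.power_idempotent[OF v v_pow_Suc_r r_pos])
  have we1: "?w \<otimes>\<^bsub>S\<^esub> e1 K r = e1 K r"
    by (rule S.absorb_power[OF v e1c ve1])
  have e1w: "e1 K r \<otimes>\<^bsub>S\<^esub> ?w = e1 K r"
    using we1 S.m_comm[OF w e1c] by simp
  \<comment> \<open>In \<open>e2 + e1\<close> the powers below \<open>r\<close> cancel and the
    coefficient of \<open>?w\<close> is \<open>(r - 1)/r + 1/r = 1\<close>. As \<open>r\<close> is
    positive, the natural number \<open>r - 1\<close> is not truncated.\<close>
  have e2: "e2 K r = ?w \<ominus>\<^bsub>S\<^esub> e1 K r"
  proof -
    let ?m = "r - 1"
    let ?s = "\<Oplus>\<^bsub>S\<^esub>i\<in>{1..?m}. ?v [^]\<^bsub>S\<^esub> i"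
    have s: "?s \<in> carrier S" using v by (intro S.finsum_closed) auto
    have "(\<Oplus>\<^bsub>S\<^esub>i\<in>{1..r}. ?v [^]\<^bsub>S\<^esub> i) = ?w \<oplus>\<^bsub>S\<^esub> ?s"
      using S.power_sum_Suc[OF v, of ?m] r_pos by simp
    then have e1': "e1 K r = ?d \<otimes>\<^bsub>S\<^esub> ?w \<oplus>\<^bsub>S\<^esub> ?d \<otimes>\<^bsub>S\<^esub> ?s"
      unfolding e1_def using d(1) w s by (simp add: S.r_distr)
    have e2': "e2 K r = \<ominus>\<^bsub>S\<^esub> (?d \<otimes>\<^bsub>S\<^esub> ?s) \<oplus>\<^bsub>S\<^esub> ([?m] \<cdot>\<^bsub>S\<^esub> ?d) \<otimes>\<^bsub>S\<^esub> ?w"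
      unfolding e2_def using add_pow_hom[OF c(1), of ?m] by simp
    have add_pow_Suc: "[Suc k] \<cdot>\<^bsub>S\<^esub> ?d = [k] \<cdot>\<^bsub>S\<^esub> ?d \<oplus>\<^bsub>S\<^esub> ?d" for k :: nat by simp
    have "[?m] \<cdot>\<^bsub>S\<^esub> ?d \<oplus>\<^bsub>S\<^esub> ?d = [r] \<cdot>\<^bsub>S\<^esub> ?d"
      using add_pow_Suc[of ?m] r_pos by simp
    also have "\<dots> = \<one>\<^bsub>S\<^esub>"
      using d S.add_pow_rdistr[OF d(1) S.one_closed, of r] by simp
    finally have "[?m] \<cdot>\<^bsub>S\<^esub> ?d \<otimes>\<^bsub>S\<^esub> ?w \<oplus>\<^bsub>S\<^esub> ?d \<otimes>\<^bsub>S\<^esub> ?w = ?w"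
      using d(1) w by (simp flip: S.l_distr)
    then have "e2 K r \<oplus>\<^bsub>S\<^esub> e1 K r = ?w"
      unfolding e1' e2' using d(1) s w
      by (simp add: S.a_ac S.r_neg1 S.r_neg2 S.r_neg S.l_neg)
    then show ?thesis using e1c e2c w by (metis S.minus_eq S.add.inv_closed S.a_assoc S.r_neg S.r_zero)
  qed
  have e3: "e3 K r = \<one>\<^bsub>S\<^esub> \<ominus>\<^bsub>S\<^esub> ?w" by (simp add: e3_def)
  note dist = S.minus_eq S.l_distr S.r_distr S.l_minus S.r_minus S.minus_add S.minus_minus
  have idem: "e2 K r \<otimes>\<^bsub>S\<^esub> e2 K r = e2 K r" "e3 K r \<otimes>\<^bsub>S\<^esub> e3 K r = e3 K r"
    using e1c w unfolding e2 e3
    by (simp_all add: dist ww e1e1 we1 e1w S.l_neg S.r_neg S.a_assoc)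
  have we3: "?w \<otimes>\<^bsub>S\<^esub> e3 K r = \<zero>\<^bsub>S\<^esub>"
    using w unfolding e3 by (simp add: dist ww S.r_neg)
  have orth: "e1 K r \<otimes>\<^bsub>S\<^esub> e2 K r = \<zero>\<^bsub>S\<^esub>" "e1 K r \<otimes>\<^bsub>S\<^esub> e3 K r = \<zero>\<^bsub>S\<^esub>"
    using e1c w unfolding e2 e3 by (simp_all add: dist e1e1 e1w S.r_neg)
  have orth23: "e2 K r \<otimes>\<^bsub>S\<^esub> e3 K r = \<zero>\<^bsub>S\<^esub>"
    using e1c w e3c unfolding e2 by (simp add: S.minus_eq S.l_distr S.l_minus we3 orth(2))
  have "e1 K r \<oplus>\<^bsub>S\<^esub> e2 K r = ?w"
    using e1c w S.a_lcomm[OF e1c w, of "\<ominus>\<^bsub>S\<^esub> e1 K r"] unfolding e2 by (simp add: S.minus_eq S.r_neg)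
  moreover have "?w \<oplus>\<^bsub>S\<^esub> e3 K r = \<one>\<^bsub>S\<^esub>"
    using w S.a_lcomm[OF w S.one_closed, of "\<ominus>\<^bsub>S\<^esub> ?w"] unfolding e3 by (simp add: S.minus_eq S.r_neg)
  ultimately have sum: "e1 K r \<oplus>\<^bsub>S\<^esub> e2 K r \<oplus>\<^bsub>S\<^esub> e3 K r = \<one>\<^bsub>S\<^esub>" by simp
  have nz1: "e1 K r \<noteq> \<zero>\<^bsub>S\<^esub>"
  proof
    assume z: "e1 K r = \<zero>\<^bsub>S\<^esub>"
    interpret E: ring_hom_cring P K "\<lambda>q. eval q \<one>" by (rule eval_hom) simp
    \<comment> \<open>A representative of \<open>r\<close> times \<open>e1\<close>. If
      \<open>e1\<close> vanished, multiplying by \<open>?n\<close> would remove the factor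
      \<open>?d\<close> and make the class of \<open>?q\<close> zero; but \<open>?q\<close> takes
      the value \<open>r\<close> at \<open>\<one>\<close>, which is nonzero in
      \<open>K\<close>.\<close>
    let ?q = "\<Oplus>\<^bsub>P\<^esub>i\<in>{1..r}. X [^]\<^bsub>P\<^esub> i"
    have q: "?q \<in> carrier P" using X_closed by (intro P.finsum_closed) auto
    let ?s = "\<Oplus>\<^bsub>S\<^esub>i\<in>{1..r}. ?v [^]\<^bsub>S\<^esub> i"
    let ?n = "[r] \<cdot>\<^bsub>S\<^esub> \<one>\<^bsub>S\<^esub>"
    have s: "?s \<in> carrier S" using v by (intro S.finsum_closed) auto
    have n: "?n \<in> carrier S" by simp
    have ds: "?d \<otimes>\<^bsub>S\<^esub> ?s = \<zero>\<^bsub>S\<^esub>" using z unfolding e1_def .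
    have "Rr_class K r ?q = ?s"
      using X_closed by (subst Q.hom_finsum) (auto simp: Rr_v_def comp_def)
    also have "\<dots> = ?d \<otimes>\<^bsub>S\<^esub> ?n \<otimes>\<^bsub>S\<^esub> ?s"
      unfolding d(2) using s by simp
    also have "\<dots> = ?n \<otimes>\<^bsub>S\<^esub> (?d \<otimes>\<^bsub>S\<^esub> ?s)"
      unfolding S.m_comm[OF d(1) n] by (rule S.m_assoc[OF n d(1) s])
    also have "\<dots> = \<zero>\<^bsub>S\<^esub>" unfolding ds by simp
    finally have "eval ?q \<one> = \<zero>" using q by (intro eval_eq_zero) simp_all
    moreover have "eval ?q \<one> = (\<Oplus>i\<in>{1..r}. \<one>)"
      using X_closed by (subst E.hom_finsum) (auto simp: eval_var comp_def)
    moreover have "(\<Oplus>i\<in>{1..r}. \<one>) = [r] \<cdot> \<one>"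
      using add.finprod_const[of \<one> "{1..r}"] by simp
    ultimately show False using r_neq_zero by simp
  qed
  have nz2: "e2 K r \<noteq> \<zero>\<^bsub>S\<^esub>"
  proof
    assume "e2 K r = \<zero>\<^bsub>S\<^esub>"
    \<comment> \<open>Now \<open>?w\<close> fixes \<open>?v\<close>, while \<open>?v\<close> fixes
      \<open>e1\<close>; equality of \<open>?w\<close> and \<open>e1\<close> therefore gives
      \<open>e1 = ?v\<close>, and \<open>ve1\<close> reads \<open>v\<^sup>2 = v\<close>.\<close>
    then have "?w = e1 K r" using e1c w by (simp add: e2)
    moreover have "?w \<otimes>\<^bsub>S\<^esub> ?v = ?v" using v_pow_Suc_r by simp
    ultimately have "e1 K r = ?v" using ve1 S.m_comm[OF v e1c] by simp
    then show False using ve1 v_square_neq_v by simp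
  qed
  have nz3: "e3 K r \<noteq> \<zero>\<^bsub>S\<^esub>"
  proof
    assume z: "e3 K r = \<zero>\<^bsub>S\<^esub>"
    interpret E: ring_hom_cring P K "\<lambda>q. eval q \<zero>" by (rule eval_hom) simp
    \<comment> \<open>A representative of \<open>e3\<close>; its value at \<open>\<zero>\<close> is
      \<open>\<one>\<close> because \<open>r\<close> is positive.\<close>
    let ?q = "\<one>\<^bsub>P\<^esub> \<ominus>\<^bsub>P\<^esub> X [^]\<^bsub>P\<^esub> r"
    have "Rr_class K r ?q = \<zero>\<^bsub>S\<^esub>"
      using z X_closed unfolding e3 v_pow by (simp add: P.minus_eq S.minus_eq)
    then have "eval ?q \<zero> = \<zero>" using X_closed by (intro eval_eq_zero) simp_all
    moreover have "eval ?q \<zero> = \<one>"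
      using X_closed r_pos by (simp add: P.minus_eq eval_var nat_pow_zero)
    ultimately show False by simp
  qed
  show ?thesis
    unfolding Rsub_def
    by (rule S.idempotents_triple_ring[OF field_axioms C.homh e1c e2c e3c e1e1 idem orth orth23 sum
          nz1 nz2 nz3])
qed

end

section \<open>Transfer to codes over the subring\<close>

theorem theorem6:
  fixes K :: "('a, 'm) ring_scheme"
    and p k r n :: nat
    and C :: "(nat \<Rightarrow> 'a list set) set"
  assumes "Factorial_Ring.prime p" and "k \<ge> 1" and "r > 1" and "coprime r p"
    and "field K" and "finite (carrier K)" and "card (carrier K) = p ^ k"
    and "linear_code (Rsub K r) n C"
  shows "internal_direct_sum3 (Rsub K r) (vec_module (Rsub K r) n)
           (dual_code (Rsub K r) n C)
           (scale_vec K r n (e1 K r) ` dual_code K n (code1 K r n C))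
           (scale_vec K r n (e2 K r) ` dual_code K n (code2 K r n C))
           (scale_vec K r n (e3 K r) ` dual_code K n (code3 K r n C))"
proof -
  \<comment> \<open>Coprimality of \<open>r\<close> and \<open>p\<close> passes to
    \<open>p ^ k\<close>, the number of elements of \<open>K\<close>.\<close>
  have "[r] \<cdot>\<^bsub>K\<^esub> \<one>\<^bsub>K\<^esub> \<noteq> \<zero>\<^bsub>K\<^esub>"
  proof (rule ring.add_pow_one_neq_zero)
    show "ring K" using assms(5) by (simp add: field_def domain_def cring_def)
    show "\<one>\<^bsub>K\<^esub> \<noteq> \<zero>\<^bsub>K\<^esub>" using assms(5) by (simp add: field_def domain_def domain_axioms_def)
  qed (use assms in simp_all)
  then interpret Rr_ring K r
    using assms(3,5) by (simp add: Rr_ring_def Rr_ring_axioms_def)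
  interpret T: triple_ring K "Rsub K r"
    "\<lambda>a b c. e1 K r \<otimes>\<^bsub>S\<^esub> Rr_const K r a \<oplus>\<^bsub>S\<^esub> e2 K r \<otimes>\<^bsub>S\<^esub> Rr_const K r b
       \<oplus>\<^bsub>S\<^esub> e3 K r \<otimes>\<^bsub>S\<^esub> Rr_const K r c"
    by (rule triple_ring_Rsub)
  have C: "C \<subseteq> {..<n} \<rightarrow>\<^sub>E carrier (Rsub K r)"
    using assms(8) subgroup.subset[OF submodule.axioms(1)] unfolding linear_code_def by fastforce
  \<comment> \<open>\<open>Rsub\<close> inherits the addition of \<open>Rr\<close>, so both sides
    agree in every coordinate.\<close>
  have comb: "comb_vec K r n s t u = T.lift n s t u" for s t u
    by (rule ext) (simp add: comb_vec_def T.lift_def scale_vec_def Rsub_def)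
  have codes: "code1 K r n C = {s \<in> T.vecs n. \<exists>t\<in>T.vecs n. \<exists>u\<in>T.vecs n. T.lift n s t u \<in> C}"
    "code2 K r n C = {t \<in> T.vecs n. \<exists>s\<in>T.vecs n. \<exists>u\<in>T.vecs n. T.lift n s t u \<in> C}"
    "code3 K r n C = {u \<in> T.vecs n. \<exists>s\<in>T.vecs n. \<exists>t\<in>T.vecs n. T.lift n s t u \<in> C}"
    by (simp_all add: code1_def code2_def code3_def comb)
  \<comment> \<open>The two additional terms in each coordinate are multiples of the image of zero.
    Dropping them requires the entries of \<open>s\<close> to lie in \<open>K\<close>, which
    membership in a dual code guarantees.\<close>
  have scale: "scale_vec K r n (e1 K r) s = T.lift n s (T.zero_vec n) (T.zero_vec n)"
    "scale_vec K r n (e2 K r) s = T.lift n (T.zero_vec n) s (T.zero_vec n)"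
    "scale_vec K r n (e3 K r) s = T.lift n (T.zero_vec n) (T.zero_vec n) s"
    if "s \<in> dual_code K n D" for s D
  proof -
    have "s j \<in> carrier K" if "j < n" for j
      using \<open>s \<in> dual_code K n D\<close> that by (auto simp: dual_code_iff PiE_iff)
    then show "scale_vec K r n (e1 K r) s = T.lift n s (T.zero_vec n) (T.zero_vec n)"
      "scale_vec K r n (e2 K r) s = T.lift n (T.zero_vec n) s (T.zero_vec n)"
      "scale_vec K r n (e3 K r) s = T.lift n (T.zero_vec n) (T.zero_vec n) s"
      using e1_closed e2_closed e3_closed by (auto simp: scale_vec_def T.lift_def fun_eq_iff)
  qed
  have images: "scale_vec K r n (e1 K r) ` dual_code K n D
      = (\<lambda>s. T.lift n s (T.zero_vec n) (T.zero_vec n)) ` dual_code K n D"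
    "scale_vec K r n (e2 K r) ` dual_code K n D
      = (\<lambda>t. T.lift n (T.zero_vec n) t (T.zero_vec n)) ` dual_code K n D"
    "scale_vec K r n (e3 K r) ` dual_code K n D
      = (\<lambda>u. T.lift n (T.zero_vec n) (T.zero_vec n) u) ` dual_code K n D" for D
    by (rule image_cong[OF refl], erule scale)+
  show ?thesis
    unfolding images codes by (rule T.dual_code_direct_sum[OF C])
qed

end
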